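(* Let $f:[a,b]\to\mathbb{R}$ be continuous, let $a=x_0<x_1<\cdots<x_p<x_{p+1}=b$ be fixed knots, let $n_0,\dots,n_p\ge1$ be integers, and let $\Sigma$ be the corresponding space of continuous splines. Let $\sigma\in\Sigma$ be such that $$\max_{a\le t\le b}[\sigma(t)-f(t)]=-\min_{a\le t\le b}[\sigma(t)-f(t)]>0 .$$ Then $\sigma$ is an optimal solution of $\min_{\tau\in\Sigma}\|\tau-f\|$ if and only if there exist indices $0\le i_1<i_2\le p+1$ such that $$\mathrm{card}(J(i_1,i_2))\ge n_{i_1}+n_{i_1+1}+\cdots+n_{i_2-1}+2 .$$
   Context: $\|g\|=\max_{t\in[a,b]}|g(t)|$. $\Pi_m$ is the set of real polynomial functions of degree at most $m$. $\Sigma$ is the set of functions $\sigma:[a,b]\to\mathbb{R}$ for which there are $\sigma_i\in\Pi_{n_i}$, $i=0,\dots,p$, with $\sigma(t)=\sigma_i(t)$ for all $t\in[x_i,x_{i+1}]$ and $\sigma_i(x_{i+1})=\sigma_{i+1}(x_{i+1})$ for $i=0,\dots,p-1$. For continuous $g:[a,b]\to\mathbb{R}$ with $M:=\max_{[a,b]}g=-\min_{[a,b]}g>0$, the alternance data of $g$ are the uniquely determined integer $k\ge1$, sign $\varepsilon\in\{-1,1\}$ and points $a\le t_0^-\le t_0^+<t_1^-\le t_1^+<\cdots<t_k^-\le t_k^+\le b$ such that $\varepsilon M=(-1)^jg(t_j^-)=(-1)^jg(t_j^+)$ for all $j$, $-M<\varepsilon(-1)^jg(t)\le M$ for $t\in[t_j^-,t_j^+]$,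 and $|g(t)|<M$ for all other $t\in[a,b]$. With $t_j^\pm$ the alternance data of $\sigma-f$, for $0\le i_1<i_2\le p+1$: $J(i_1,i_2)=\{j\in\{0,\dots,k\}: t_j^-\in[x_{i_1},x_{i_2}]\text{ or }t_j^+\in[x_{i_1},x_{i_2}]\}$. *)

theory Defs
  imports "HOL-Analysis.Analysis" "HOL-Computational_Algebra.Polynomial"
begin

text \<open>
  Functions on \<open>[a,b]\<close> are represented by total functions \<open>real \<Rightarrow> real\<close>; no notion below depends
  on values outside \<open>[a,b]\<close>. Maxima and minima over \<open>[a,b]\<close> are written as suprema and infima of
  the image, which are attained because they are only applied to continuous functions.
\<close>

definition sup_norm :: "real \<Rightarrow> real \<Rightarrow> (real \<Rightarrow> real) \<Rightarrow> real" where
  "sup_norm a b g = (SUP t\<in>{a..b}. \<bar>g t\<bar>)"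

definition poly_funs :: "nat \<Rightarrow> (real \<Rightarrow> real) set" where
  "poly_funs m = {poly q |q. degree q \<le> m}"

definition splines :: "nat \<Rightarrow> (nat \<Rightarrow> real) \<Rightarrow> (nat \<Rightarrow> nat) \<Rightarrow> (real \<Rightarrow> real) set" where
  "splines p x n =
     {\<sigma>. \<exists>s. (\<forall>i\<le>p. s i \<in> poly_funs (n i)) \<and>
            (\<forall>i\<le>p. \<forall>t\<in>{x i..x (Suc i)}. \<sigma> t = s i t) \<and>
            (\<forall>i<p. s i (x (Suc i)) = s (Suc i) (x (Suc i)))}"

text \<open>
  \<open>tm j\<close> and \<open>tp j\<close> stand for \<open>t\<^sub>j\<^sup>-\<close> and \<open>t\<^sub>j\<^sup>+\<close>. They are extensional functions on \<open>{0..k}\<close>, so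
  that the data are determined uniquely, as required by the definite description below.
\<close>

definition is_alternance_data ::
  "real \<Rightarrow> real \<Rightarrow> (real \<Rightarrow> real) \<Rightarrow> nat \<Rightarrow> real \<Rightarrow> (nat \<Rightarrow> real) \<Rightarrow> (nat \<Rightarrow> real) \<Rightarrow> bool" where
  "is_alternance_data a b g k \<epsilon> tm tp \<longleftrightarrow>
     (let M = (SUP t\<in>{a..b}. g t) in
        k \<ge> 1 \<and> \<epsilon> \<in> {-1, 1} \<and>
        tm \<in> {0..k} \<rightarrow>\<^sub>E {a..b} \<and> tp \<in> {0..k} \<rightarrow>\<^sub>E {a..b} \<and>
        (\<forall>j\<le>k. tm j \<le> tp j) \<and> (\<forall>j<k. tp j < tm (Suc j)) \<and>
        (\<forall>j\<le>k. \<epsilon> * M = (-1) ^ j * g (tm j) \<and> \<epsilon> * M = (-1) ^ j * g (tp j)) \<and>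
        (\<forall>j\<le>k. \<forall>t\<in>{tm j..tp j}. - M < \<epsilon> * (-1) ^ j * g t \<and> \<epsilon> * (-1) ^ j * g t \<le> M) \<and>
        (\<forall>t\<in>{a..b} - (\<Union>j\<le>k. {tm j..tp j}). \<bar>g t\<bar> < M))"

definition alternance_data ::
  "real \<Rightarrow> real \<Rightarrow> (real \<Rightarrow> real) \<Rightarrow> nat \<times> real \<times> (nat \<Rightarrow> real) \<times> (nat \<Rightarrow> real)" where
  "alternance_data a b g = (THE (k, \<epsilon>, tm, tp). is_alternance_data a b g k \<epsilon> tm tp)"

definition alternance_indices ::
  "real \<Rightarrow> real \<Rightarrow> (real \<Rightarrow> real) \<Rightarrow> (nat \<Rightarrow> real) \<Rightarrow> nat \<Rightarrow> nat \<Rightarrow> nat set" where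
  "alternance_indices a b g x i\<^sub>1 i\<^sub>2 =
     (case alternance_data a b g of (k, \<epsilon>, tm, tp) \<Rightarrow>
        {j \<in> {0..k}. tm j \<in> {x i\<^sub>1..x i\<^sub>2} \<or> tp j \<in> {x i\<^sub>1..x i\<^sub>2}})"

end

theory Submission imports Defs begin

text \<open>
  Let \<open>g = \<sigma> - f\<close> and \<open>M = \<parallel>g\<parallel>\<close>. A better spline exists iff some spline \<open>d\<close> satisfies \<open>\<bar>g - d\<bar> < M\<close> on
  \<open>[a,b]\<close>, and such a \<open>d\<close> has the sign of \<open>g\<close> at every extremal point of \<open>g\<close>.

  A spline has at most \<open>n\<^sub>i\<close> sign changes on the \<open>i\<close>-th piece, hence at most the sum of the \<open>n\<^sub>i\<close> on
  \<open>[x\<^bsub>i1\<^esub>, x\<^bsub>i2\<^esub>]\<close>; this rules out \<open>d\<close> when \<open>J(i1,i2)\<close> is large.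

  Conversely, a \<open>d\<close> is found by placing one zero in each gap between consecutive alternance blocks, such
  that the \<open>i\<close>-th piece receives at most \<open>n\<^sub>i\<close> of them. Each gap meets an interval of pieces, and the gaps
  that meet only pieces between \<open>i1\<close> and \<open>i2\<close> number at most \<open>card J(i1,i2) - 1\<close>, so Hall's
  condition is the negation of the alternance condition. A small multiple of \<open>d\<close> improves \<open>\<sigma>\<close>.
\<close>

section \<open>Sign changes of splines\<close>

lemma mono_upto:
  fixes s :: "nat \<Rightarrow> real"
  assumes "\<And>j. j < r \<Longrightarrow> s j < s (Suc j)" and "i \<le> j" "j \<le> r"
  shows "s i \<le> s j"
  using assms(2,3)
proof (induction j rule: dec_induct)
  case (step j)
  then show ?case using assms(1)[of j] by simp
qed simp

text \<open>The intermediate value theorem gives a root strictly between any two consecutive points.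
  These \<open>r\<close> roots lie in disjoint gaps, hence are distinct, and a nonzero polynomial
  has at most \<open>degree q\<close> roots.\<close>

lemma poly_alternation_le_degree:
  fixes q :: "real poly" and s :: "nat \<Rightarrow> real"
  assumes inc: "\<And>j. j < r \<Longrightarrow> s j < s (Suc j)"
    and alt: "\<And>j. j \<le> r \<Longrightarrow> \<eta> * (-1) ^ j * poly q (s j) > 0"
  shows "r \<le> degree q"
proof -
  have "\<exists>z. s j < z \<and> z < s (Suc j) \<and> poly q z = 0" if j: "j < r" for j
  proof -
    have "(\<eta> * (-1) ^ j * poly q (s j)) * (\<eta> * (-1) ^ Suc j * poly q (s (Suc j))) > 0"
      using mult_pos_pos[OF alt[of j] alt[of "Suc j"]] j by simp_all
    \<comment> \<open>The two sign factors are negatives of each other, so a square with a minus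
      sign splits off and the two values of \<open>q\<close> must have opposite signs.\<close>
    also have "(\<eta> * (-1) ^ j * poly q (s j)) * (\<eta> * (-1) ^ Suc j * poly q (s (Suc j)))
        = - (\<eta> * (-1) ^ j)\<^sup>2 * (poly q (s j) * poly q (s (Suc j)))"
      by (simp add: power2_eq_square algebra_simps)
    finally have "poly q (s j) * poly q (s (Suc j)) < 0"
      using zero_le_power2[of "\<eta> * (-1) ^ j"] by (smt (verit) mult_nonneg_nonneg mult_minus_left)
    from poly_IVT[OF inc[OF j] this] show ?thesis by auto
  qed
  then obtain z where z: "\<And>j. j < r \<Longrightarrow> s j < z j \<and> z j < s (Suc j) \<and> poly q (z j) = 0"
    by metis
  have mono: "i \<le> j \<Longrightarrow> j \<le> r \<Longrightarrow> s i \<le> s j" for i j using mono_upto[of r s] inc by blast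
  have "z i < z j" if "i < j" "j < r" for i j
    using z[of i] z[of j] mono[of "Suc i" j] that by auto
  then have "inj_on z {..<r}"
    by (metis inj_onI lessThan_iff linorder_neqE_nat order_less_irrefl)
  then have "r = card (z ` {..<r})" by (simp add: card_image)
  moreover have q: "q \<noteq> 0" using alt[of 0] by auto
  then have "card (z ` {..<r}) \<le> card {x. poly q x = 0}"
    by (intro card_mono poly_roots_finite) (use z in auto)
  ultimately show ?thesis using card_poly_roots_bound[OF q] by linarith
qed

text \<open>Induction on the last knot: the points are split at \<open>v = x i2\<close>, the
  induction hypothesis bounds the left part and the degree of the last piece bounds the right part.
  Because \<open>d v\<close> is nonzero, \<open>v\<close> can join one of the two parts, so the sign
  change that straddles the knot is still counted.\<close>

lemma piecewise_poly_alternation_le: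
  fixes d :: "real \<Rightarrow> real" and x s :: "nat \<Rightarrow> real" and n :: "nat \<Rightarrow> nat"
  assumes "i1 \<le> i2"
    and "\<And>i. i1 \<le> i \<Longrightarrow> i < i2 \<Longrightarrow> x i \<le> x (Suc i)"
    and "\<And>i. i1 \<le> i \<Longrightarrow> i < i2 \<Longrightarrow> \<exists>q. degree q \<le> n i \<and> (\<forall>t\<in>{x i..x (Suc i)}. d t = poly q t)"
    and "\<And>i. i1 \<le> i \<Longrightarrow> i \<le> i2 \<Longrightarrow> d (x i) \<noteq> 0"
    and "\<And>j. j < r \<Longrightarrow> s j < s (Suc j)"
    and "\<And>j. j \<le> r \<Longrightarrow> s j \<in> {x i1..x i2}"
    and "\<And>j. j \<le> r \<Longrightarrow> \<eta> * (-1) ^ j * d (s j) > 0"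
  shows "r \<le> (\<Sum>i\<in>{i1..<i2}. n i)"
  using assms
proof (induction i2 arbitrary: r s \<eta> rule: dec_induct)
  case base
  show ?case
  proof (rule ccontr)
    assume r: "\<not> ?thesis"
    then have "s 0 < s 1" using base.prems(4)[of 0] r by simp
    moreover have "s 0 = x i1" "s 1 = x i1"
      using base.prems(5)[of 0] base.prems(5)[of 1] r by auto
    ultimately show False by simp
  qed
next
  case (step i2)
  define v where "v = x i2"
  have sum: "(\<Sum>i\<in>{i1..<Suc i2}. n i) = (\<Sum>i\<in>{i1..<i2}. n i) + n i2"
    using step.hyps by simp
  have mono: "i \<le> j \<Longrightarrow> j \<le> r \<Longrightarrow> s i \<le> s j" for i j using mono_upto[of r s] step.prems(4) by blast
  have left: "r' \<le> (\<Sum>i\<in>{i1..<i2}. n i)"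
    if "\<And>j. j < r' \<Longrightarrow> s' j < s' (Suc j)" "\<And>j. j \<le> r' \<Longrightarrow> s' j \<in> {x i1..v}"
       "\<And>j. j \<le> r' \<Longrightarrow> \<eta>' * (-1) ^ j * d (s' j) > 0" for r' s' \<eta>'
    by (rule step.IH[where s = s' and \<eta> = \<eta>']) (use step.prems(1-3) that step.hyps in \<open>auto simp: v_def\<close>)
  obtain q where q: "degree q \<le> n i2" "\<And>t. t \<in> {v..x (Suc i2)} \<Longrightarrow> d t = poly q t"
    using step.prems(2)[of i2] step.hyps by (auto simp: v_def)
  have right: "r' \<le> n i2"
    if "\<And>j. j < r' \<Longrightarrow> s' j < s' (Suc j)" "\<And>j. j \<le> r' \<Longrightarrow> s' j \<in> {v..x (Suc i2)}"
       "\<And>j. j \<le> r' \<Longrightarrow> \<eta>' * (-1) ^ j * d (s' j) > 0" for r' s' \<eta>'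
  proof -
    have "r' \<le> degree q"
      by (rule poly_alternation_le_degree[where s = s' and \<eta> = \<eta>']) (use that q(2) in \<open>auto simp del: atLeastAtMost_iff\<close>)
    then show ?thesis using q(1) by simp
  qed
  have xv: "x i1 \<le> v"
    using step.hyps(1) step.prems(1) unfolding v_def
    by (induction i2 rule: dec_induct) (auto intro: order.trans)
  have v: "v \<le> x (Suc i2)" using step.prems(1)[of i2] step.hyps by (auto simp: v_def)
  have dv: "d v \<noteq> 0" using step.prems(3)[of i2] step.hyps by (auto simp: v_def)
  consider "v < s 0" | "s r \<le> v" | m where "m < r" "s m \<le> v" "v < s (Suc m)"
  proof -
    have "s r \<le> v" if "s 0 \<le> v" "\<not> (\<exists>m<r. s m \<le> v \<and> v < s (Suc m))"
    proof -
      have "j \<le> r \<Longrightarrow> s j \<le> v" for j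
        by (induction j) (use that in \<open>auto simp: not_less\<close>)
      then show ?thesis by simp
    qed
    then show thesis using that by (meson not_less)
  qed
  then show ?case
  proof cases
    case 1
    then have "s j \<in> {v..x (Suc i2)}" if "j \<le> r" for j
      using mono[of 0 j] step.prems(5)[of j] that by auto
    then have "r \<le> n i2" using right[of r s \<eta>] step.prems(4,6) by blast
    then show ?thesis using sum by simp
  next
    case 2
    then have "s j \<in> {x i1..v}" if "j \<le> r" for j
      using mono[of j r] step.prems(5)[of j] that by auto
    then have "r \<le> (\<Sum>i\<in>{i1..<i2}. n i)" using left[of r s \<eta>] step.prems(4,6) by blast
    then show ?thesis using sum by simp
  next
    case 3
    have before: "s j \<in> {x i1..v}" if "j \<le> m" for j
      using mono[OF that] step.prems(5)[of j] 3 that by auto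
    have after: "s j \<in> {v<..x (Suc i2)}" if "Suc m \<le> j" "j \<le> r" for j
      using mono[OF that] step.prems(5)[of j] 3 that by auto
    have inc: "s j < s (Suc j)" if "j < r" for j using step.prems(4) that .
    have alt: "\<eta> * (-1) ^ j * d (s j) > 0" if "j \<le> r" for j using step.prems(6) that .
    \<comment> \<open>If \<open>d v\<close> has the sign of \<open>d (s m)\<close>, the straddling
      change happens after \<open>v\<close>, and \<open>v\<close> replaces \<open>s m\<close> as the
      first point on the right. Otherwise it happens before \<open>v\<close>, and \<open>v\<close>
      is appended on the left as point number \<open>m + 1\<close>.\<close>
    show ?thesis
    proof (cases "\<eta> * (-1) ^ m * d v > 0")
      case True
      have "m \<le> (\<Sum>i\<in>{i1..<i2}. n i)"
      proof (rule left[of m s \<eta>])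
        show "s j < s (Suc j)" if "j < m" for j using inc that 3 by simp
        show "\<eta> * (-1) ^ j * d (s j) > 0" if "j \<le> m" for j using alt that 3 by simp
      qed (rule before)
      moreover have "r - m \<le> n i2"
      proof (rule right[of _ "\<lambda>j. if j = 0 then v else s (m + j)" "\<eta> * (-1) ^ m"])
        fix j assume j: "j \<le> r - m"
        show "(if j = 0 then v else s (m + j)) \<in> {v..x (Suc i2)}"
          using after[of "m + j"] j v 3 by (cases "m + j \<le> r") auto
        show "\<eta> * (-1) ^ m * (-1) ^ j * d (if j = 0 then v else s (m + j)) > 0"
          using True alt[of "m + j"] j 3 by (auto simp: power_add mult.assoc)
      next
        fix j assume j: "j < r - m"
        show "(if j = 0 then v else s (m + j)) < (if Suc j = 0 then v else s (m + Suc j))"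
          using inc[of "m + j"] j 3 by auto
      qed
      ultimately show ?thesis using sum 3 by linarith
    next
      case False
      have eta: "\<eta> \<noteq> 0" using alt[of 0] by auto
      have pos: "\<eta> * (-1) ^ Suc m * d v > 0"
      proof -
        have "\<eta> * (-1) ^ m * d v \<noteq> 0" using dv eta by simp
        then have "\<eta> * (-1) ^ m * d v < 0" using False by linarith
        then show ?thesis by simp
      qed
      have "Suc m \<le> (\<Sum>i\<in>{i1..<i2}. n i)"
      proof (rule left[of _ "\<lambda>j. if j = Suc m then v else s j" \<eta>])
        fix j assume j: "j \<le> Suc m"
        show "(if j = Suc m then v else s j) \<in> {x i1..v}"
          using before[of j] j xv by auto
        show "\<eta> * (-1) ^ j * d (if j = Suc m then v else s j) > 0"
          using pos alt[of j] j 3 by auto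
      next
        fix j assume j: "j < Suc m"
        have "s m \<noteq> v" using False alt[of m] 3 by auto
        then show "(if j = Suc m then v else s j) < (if Suc j = Suc m then v else s (Suc j))"
          using inc[of j] j 3 by auto
      qed
      moreover have "r - Suc m \<le> n i2"
      proof (rule right[of _ "\<lambda>j. s (Suc m + j)" "\<eta> * (-1) ^ Suc m"])
        fix j assume j: "j \<le> r - Suc m"
        show "s (Suc m + j) \<in> {v..x (Suc i2)}"
          using after[of "Suc m + j"] j 3 by (cases "Suc m + j \<le> r") auto
        show "\<eta> * (-1) ^ Suc m * (-1) ^ j * d (s (Suc m + j)) > 0"
          using alt[of "Suc m + j"] j 3 by (simp add: power_add mult.assoc)
      next
        fix j assume "j < r - Suc m"
        then show "s (Suc m + j) < s (Suc m + Suc j)"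
          using inc[of "Suc m + j"] by simp
      qed
      ultimately show ?thesis using sum 3 by linarith
    qed
  qed
qed

text \<open>A sign change located exactly at a knot would be missed by counting piece by piece. Subtracting a
  small constant makes all knot values nonzero and keeps the alternation.\<close>

lemma spline_alternation_le:
  fixes d :: "real \<Rightarrow> real" and x s :: "nat \<Rightarrow> real" and n :: "nat \<Rightarrow> nat"
  assumes "i1 \<le> i2"
    and "\<And>i. i1 \<le> i \<Longrightarrow> i < i2 \<Longrightarrow> x i \<le> x (Suc i)"
    and poly: "\<And>i. i1 \<le> i \<Longrightarrow> i < i2 \<Longrightarrow>
      \<exists>q. degree q \<le> n i \<and> (\<forall>t\<in>{x i..x (Suc i)}. d t = poly q t)"
    and "\<And>j. j < r \<Longrightarrow> s j < s (Suc j)"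
    and "\<And>j. j \<le> r \<Longrightarrow> s j \<in> {x i1..x i2}"
    and alt: "\<And>j. j \<le> r \<Longrightarrow> \<eta> * (-1) ^ j * d (s j) > 0"
  shows "r \<le> (\<Sum>i\<in>{i1..<i2}. n i)"
proof -
  define \<mu> where "\<mu> = Min ((\<lambda>j. \<bar>d (s j)\<bar>) ` {..r})"
  have nz: "d (s j) \<noteq> 0" if "j \<le> r" for j using alt[OF that] by auto
  then have "\<mu> > 0" unfolding \<mu>_def by (subst Min_gr_iff) auto
  then have "infinite ({0<..<\<mu>} - (\<lambda>i. d (x i)) ` {i1..i2})"
    by (intro Diff_infinite_finite) auto
  then have "{0<..<\<mu>} - (\<lambda>i. d (x i)) ` {i1..i2} \<noteq> {}" by (intro notI) simp
  then obtain c where "c \<in> {0<..<\<mu>} - (\<lambda>i. d (x i)) ` {i1..i2}" by blast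
  then have c: "0 < c" "c < \<mu>" "c \<notin> (\<lambda>i. d (x i)) ` {i1..i2}" by simp_all
  have small: "c < \<bar>d (s j)\<bar>" if "j \<le> r" for j
    using c(2) that unfolding \<mu>_def by (subst (asm) Min_gr_iff) auto
  show ?thesis
  proof (rule piecewise_poly_alternation_le[where d = "\<lambda>t. d t - c"])
    show "\<exists>q. degree q \<le> n i \<and> (\<forall>t\<in>{x i..x (Suc i)}. d t - c = poly q t)"
      if i: "i1 \<le> i" "i < i2" for i
    proof -
      obtain q where "degree q \<le> n i" "\<forall>t\<in>{x i..x (Suc i)}. d t = poly q t"
        using poly[OF i] by blast
      then show ?thesis by (intro exI[of _ "q - [:c:]"]) (auto intro: degree_diff_le)
    qed
    show "\<eta> * (-1) ^ j * (d (s j) - c) > 0" if j: "j \<le> r" for j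
    proof -
      define e where "e = \<eta> * (-1) ^ j"
      have "e * d (s j) > 0" using alt[OF j] by (simp add: e_def)
      then have "e * (d (s j) - c) > 0"
        using small[OF j] c(1) by (auto simp: zero_less_mult_iff)
      then show ?thesis by (simp add: e_def)
    qed
  qed (use assms c in auto)
qed

section \<open>Assigning gaps to pieces\<close>

text \<open>Greedy choice: \<open>s j\<close> is the least value compatible with all lower bounds
  \<open>L i\<close>, \<open>i \<le> j\<close>, when each later index costs at least one more step.
  The hypothesis says that this value stays below \<open>R j\<close>.\<close>

lemma increasing_selection:
  fixes L R :: "nat \<Rightarrow> nat"
  assumes LR: "\<And>i j. i \<le> j \<Longrightarrow> j < k \<Longrightarrow> L i + (j - i) < R j"
  obtains s where "\<And>j. j < k \<Longrightarrow> L j \<le> s j \<and> s j < R j" "\<And>i j. i < j \<Longrightarrow> j < k \<Longrightarrow> s i < s j"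
proof
  define s where "s j = Max ((\<lambda>i. L i + (j - i)) ` {..j})" for j
  have ge: "L i + (j - i) \<le> s j" if "i \<le> j" for i j
    unfolding s_def by (rule Max_ge) (use that in auto)
  have attained: "\<exists>i\<le>j. s j = L i + (j - i)" for j
    using Max_in[of "(\<lambda>i. L i + (j - i)) ` {..j}"] unfolding s_def by fastforce
  show "L j \<le> s j \<and> s j < R j" if "j < k" for j
    using ge[of j j] attained[of j] LR that by auto
  show "s i < s j" if ij: "i < j" "j < k" for i j
  proof -
    obtain m where "m \<le> i" "s i = L m + (i - m)" using attained by blast
    then show ?thesis using ge[of m j] ij by auto
  qed
qed

text \<open>Hall's theorem for intervals: person \<open>j\<close> accepts the rooms \<open>l j, \<dots>, r j\<close>, room \<open>i\<close> has \<open>n i\<close> beds,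
  and the beds are numbered consecutively so that the greedy choice applies.\<close>

lemma capacity_assignment:
  fixes l r n :: "nat \<Rightarrow> nat"
  assumes "\<And>i j. i \<le> j \<Longrightarrow> j < k \<Longrightarrow> l i \<le> r j \<and> j - i + 1 \<le> (\<Sum>m\<in>{l i..<Suc (r j)}. n m)"
  obtains \<pi> where "\<And>j. j < k \<Longrightarrow> l j \<le> \<pi> j \<and> \<pi> j \<le> r j"
    "\<And>i. card {j. j < k \<and> \<pi> j = i} \<le> n i"
proof -
  \<comment> \<open>\<open>C i\<close> counts the beds in the rooms before \<open>i\<close>, so room
    \<open>i\<close> owns the bed numbers in \<open>{C i..<C (Suc i)}\<close>.\<close>
  define C where "C i = (\<Sum>m<i. n m)" for i
  have C_mono: "i \<le> j \<Longrightarrow> C i \<le> C j" for i j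
    unfolding C_def by (intro sum_mono2) auto
  have "C (l i) + (j - i) < C (Suc (r j))" if "i \<le> j" "j < k" for i j
  proof -
    have "C (Suc (r j)) = C (l i) + (\<Sum>m\<in>{l i..<Suc (r j)}. n m)"
      using assms[OF that] unfolding C_def lessThan_atLeast0
      by (intro sum.atLeastLessThan_concat[symmetric]) auto
    then show ?thesis using assms[OF that] by linarith
  qed
  then obtain s where s: "\<And>j. j < k \<Longrightarrow> C (l j) \<le> s j \<and> s j < C (Suc (r j))"
    and s_less: "\<And>i j. i < j \<Longrightarrow> j < k \<Longrightarrow> s i < s j"
    using increasing_selection[of k "\<lambda>i. C (l i)" "\<lambda>j. C (Suc (r j))"] by metis
  have "\<exists>i. C i \<le> s j \<and> s j < C (Suc i)" if "j < k" for j
  proof -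
    \<comment> \<open>The room of bed \<open>s j\<close> is the first one whose beds end beyond
      it.\<close>
    define i where "i = (LEAST i. s j < C (Suc i))"
    have "s j < C (Suc i)" unfolding i_def by (rule LeastI) (use s[OF that] in blast)
    moreover have "C i \<le> s j"
    proof (cases i)
      case 0
      then show ?thesis by (simp add: C_def)
    next
      case (Suc i')
      then show ?thesis using not_less_Least[of i' "\<lambda>i. s j < C (Suc i)"] by (simp add: i_def)
    qed
    ultimately show ?thesis by blast
  qed
  then obtain \<pi> where \<pi>: "\<And>j. j < k \<Longrightarrow> C (\<pi> j) \<le> s j \<and> s j < C (Suc (\<pi> j))"
    by metis
  show thesis
  proof
    show "l j \<le> \<pi> j \<and> \<pi> j \<le> r j" if "j < k" for j
    proof -
      have "C (l j) < C (Suc (\<pi> j))" "C (\<pi> j) < C (Suc (r j))"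
        using s[OF that] \<pi>[OF that] by linarith+
      then show ?thesis using C_mono by (meson leD not_less_eq_eq)
    qed
    show "card {j. j < k \<and> \<pi> j = i} \<le> n i" for i
    proof -
      have "card {j. j < k \<and> \<pi> j = i} \<le> card {C i..<C (Suc i)}"
      proof (rule card_inj_on_le)
        show "inj_on s {j. j < k \<and> \<pi> j = i}"
          by (rule inj_onI) (metis (mono_tags, lifting) mem_Collect_eq linorder_neqE_nat order_less_irrefl s_less)
      qed (use \<pi> in auto)
      then show ?thesis by (simp add: C_def)
    qed
  qed
qed

text \<open>Applied to the comparison of knots with a fixed point, this finds the piece that
  contains the point.\<close>

lemma exists_last_true:
  fixes P :: "nat \<Rightarrow> bool"
  assumes "P 0" "\<not> P (Suc p)" shows "\<exists>i\<le>p. P i \<and> \<not> P (Suc i)"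
  using assms by (induction p) (metis le_refl, metis le_SucI le_refl)

section \<open>Alternance data\<close>

text \<open>Working form of the alternance conditions. The level \<open>M\<close> and the left end
  \<open>c\<close> are parameters and \<open>k = 0\<close> is allowed, so that an induction can pass
  to a tail of the interval. The last clause expresses the strict bound off the blocks as a covering
  of all extremal points.\<close>

definition alternating_blocks ::
  "(real \<Rightarrow> real) \<Rightarrow> real \<Rightarrow> real \<Rightarrow> real \<Rightarrow> nat \<Rightarrow> real \<Rightarrow> (nat \<Rightarrow> real) \<Rightarrow> (nat \<Rightarrow> real) \<Rightarrow> bool" where
  "alternating_blocks g M c b k \<epsilon> tm tp \<longleftrightarrow>
     \<epsilon> \<in> {-1, 1} \<and>
     (\<forall>j\<le>k. c \<le> tm j \<and> tm j \<le> tp j \<and> tp j \<le> b) \<and> (\<forall>j<k. tp j < tm (Suc j)) \<and>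
     (\<forall>j\<le>k. g (tm j) = \<epsilon> * (-1) ^ j * M \<and> g (tp j) = \<epsilon> * (-1) ^ j * M) \<and>
     (\<forall>j\<le>k. \<forall>t\<in>{tm j..tp j}. - M < \<epsilon> * (-1) ^ j * g t) \<and>
     (\<forall>t\<in>{c..b}. \<bar>g t\<bar> = M \<longrightarrow> (\<exists>j\<le>k. t \<in> {tm j..tp j}))"

context
  fixes g :: "real \<Rightarrow> real" and M c b k \<epsilon> tm tp
  assumes blocks: "alternating_blocks g M c b k \<epsilon> tm tp"
begin

lemma blocks_sign: "\<epsilon> = -1 \<or> \<epsilon> = 1"
  using blocks by (auto simp: alternating_blocks_def)

lemma blocks_between:
  assumes "j \<le> k" shows "c \<le> tm j" "tm j \<le> tp j" "tp j \<le> b"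
  using blocks assms by (auto simp: alternating_blocks_def)

lemma blocks_Suc: "j < k \<Longrightarrow> tp j < tm (Suc j)"
  using blocks by (auto simp: alternating_blocks_def)

lemma blocks_value:
  assumes "j \<le> k" shows "g (tm j) = \<epsilon> * (-1) ^ j * M" "g (tp j) = \<epsilon> * (-1) ^ j * M"
  using blocks assms by (auto simp: alternating_blocks_def)

lemma blocks_inside: "j \<le> k \<Longrightarrow> tm j \<le> t \<Longrightarrow> t \<le> tp j \<Longrightarrow> - M < \<epsilon> * (-1) ^ j * g t"
  using blocks by (auto simp: alternating_blocks_def)

lemma blocks_cover:
  assumes "c \<le> t" "t \<le> b" "\<bar>g t\<bar> = M" obtains j where "j \<le> k" "tm j \<le> t" "t \<le> tp j"
  using blocks assms by (auto simp: alternating_blocks_def)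

lemma blocks_tm_mono: "i \<le> j \<Longrightarrow> j \<le> k \<Longrightarrow> tm i \<le> tm j"
proof (induction j rule: dec_induct)
  case (step j)
  then show ?case using blocks_between[of j] blocks_Suc[of j] by simp
qed simp

lemma blocks_less: "i < j \<Longrightarrow> j \<le> k \<Longrightarrow> tp i < tm j"
  using blocks_tm_mono[of "Suc i" j] blocks_Suc[of i] by simp

lemma blocks_tp_mono: "i \<le> j \<Longrightarrow> j \<le> k \<Longrightarrow> tp i \<le> tp j"
  using blocks_less[of i j] blocks_between[of j] by (cases "i = j") auto

lemma blocks_extreme:
  assumes "j \<le> k" "M \<ge> 0" shows "\<bar>g (tm j)\<bar> = M" "\<bar>g (tp j)\<bar> = M"
  using blocks_value[OF assms(1)] blocks_sign assms(2) by (auto simp: abs_mult)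

end

section \<open>Uniqueness of the alternance blocks\<close>

context
  fixes g :: "real \<Rightarrow> real" and M c b k \<epsilon> tm tp k' \<epsilon>' tm' tp'
  assumes b1: "alternating_blocks g M c b k \<epsilon> tm tp"
    and b2: "alternating_blocks g M c b k' \<epsilon>' tm' tp'"
    and M: "M > 0"
begin

text \<open>\<open>tm 0\<close> is extremal, so some block of the second system contains it, and
  that block starts no earlier than \<open>tm' 0\<close>.\<close>

lemma blocks_tm_0_le: "tm' 0 \<le> tm 0"
proof -
  obtain j where "j \<le> k'" "tm' j \<le> tm 0"
    using blocks_cover[OF b2, of "tm 0"] blocks_between[OF b1, of 0] blocks_extreme[OF b1, of 0] M
    by force
  then show ?thesis using blocks_tm_mono[OF b2, of 0 j] by simp
qed

text \<open>If \<open>tp j < tp' j\<close>, then the extremal point \<open>tp' j\<close> lies in a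
  later block of the first system. Hence \<open>tm (Suc j)\<close>, where \<open>g\<close> has the
  opposite sign, falls into block \<open>j\<close> of the second system, which excludes that
  value.\<close>

lemma blocks_tp_le:
  assumes "j \<le> k" "j \<le> k'" "tm j = tm' j" "\<epsilon> = \<epsilon>'"
  shows "tp' j \<le> tp j"
proof (rule ccontr)
  assume "\<not> ?thesis"
  then have less: "tp j < tp' j" by simp
  obtain l where l: "l \<le> k" "tm l \<le> tp' j" "tp' j \<le> tp l"
    using blocks_cover[OF b1, of "tp' j"] blocks_between[OF b2, of j] blocks_extreme[OF b2, of j]
      M assms by force
  then have jl: "j < l"
    using less blocks_tp_mono[OF b1, of l j] assms by (meson leI order.strict_trans1 order.trans leD)
  then have "tm (Suc j) \<le> tp' j" "Suc j \<le> k" using l blocks_tm_mono[OF b1, of "Suc j" l] by auto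
  moreover have "tm' j \<le> tm (Suc j)"
    using blocks_tm_mono[OF b1, of j "Suc j"] \<open>Suc j \<le> k\<close> assms by simp
  ultimately have "- M < \<epsilon>' * (-1) ^ j * g (tm (Suc j))"
    using blocks_inside[OF b2, of j] assms by simp
  also have "\<dots> = - M"
    using blocks_value[OF b1, of "Suc j"] \<open>Suc j \<le> k\<close> blocks_sign[OF b1] assms(4)
    by (cases "even j") auto
  finally show False by simp
qed

text \<open>\<open>tm (Suc j)\<close> is extremal and lies beyond \<open>tp' j\<close>, so the
  second system must have a block of index above \<open>j\<close> that covers it.\<close>

lemma blocks_tm_Suc_le:
  assumes "j < k" "j \<le> k'" "tp j = tp' j"
  shows "j < k'" "tm' (Suc j) \<le> tm (Suc j)"
proof -
  obtain l where l: "l \<le> k'" "tm' l \<le> tm (Suc j)" "tm (Suc j) \<le> tp' l"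
    using blocks_cover[OF b2, of "tm (Suc j)"] blocks_between[OF b1, of "Suc j"]
      blocks_extreme[OF b1, of "Suc j"] M assms by force
  have "j < l"
  proof (rule ccontr)
    assume "\<not> j < l"
    then have "tp' l \<le> tp' j" using blocks_tp_mono[OF b2, of l j] assms by simp
    then show False using l blocks_Suc[OF b1, of j] assms by simp
  qed
  then show "j < k'" "tm' (Suc j) \<le> tm (Suc j)"
    using l blocks_tm_mono[OF b2, of "Suc j" l] by auto
qed

end

text \<open>The one-sided comparisons, used in both directions, become equalities. They determine
  first \<open>tm 0\<close>, then the sign, and then in turn each right end and the next left
  end.\<close>

lemma blocks_unique_upto:
  assumes b1: "alternating_blocks g M c b k \<epsilon> tm tp"
    and b2: "alternating_blocks g M c b k' \<epsilon>' tm' tp'"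
    and M: "M > 0"
  shows "\<epsilon> = \<epsilon>'" "j \<le> k \<Longrightarrow> j \<le> k' \<and> tm j = tm' j \<and> tp j = tp' j"
proof -
  have tm0: "tm 0 = tm' 0"
    using blocks_tm_0_le[OF b1 b2 M] blocks_tm_0_le[OF b2 b1 M] by simp
  then show eps: "\<epsilon> = \<epsilon>'"
    using blocks_value[OF b1, of 0] blocks_value[OF b2, of 0] M by simp
  have tp: "tp j = tp' j" if "j \<le> k" "j \<le> k'" "tm j = tm' j" for j
    using blocks_tp_le[OF b1 b2 M that eps] blocks_tp_le[OF b2 b1 M, of j] that eps by simp
  show "j \<le> k' \<and> tm j = tm' j \<and> tp j = tp' j" if "j \<le> k"
    using that
  proof (induction j)
    case 0
    then show ?case using tm0 tp[of 0] by simp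
  next
    case (Suc j)
    then have j: "j < k" "j \<le> k'" "tp j = tp' j" by auto
    note 1 = blocks_tm_Suc_le[OF b1 b2 M j]
    have "tm (Suc j) \<le> tm' (Suc j)"
      using blocks_tm_Suc_le[OF b2 b1 M, of j] 1 j by simp
    then have "tm (Suc j) = tm' (Suc j)" using 1 by simp
    then show ?case using 1 tp[of "Suc j"] j by simp
  qed
qed

section \<open>Existence of the alternance blocks\<close>

lemma compact_level:
  fixes g :: "real \<Rightarrow> real"
  assumes "continuous_on {c..b} g" shows "compact {t \<in> {c..b}. g t = y}"
  using continuous_closed_preimage[OF assms closed_atLeastAtMost, of "{y}"]
    compact_Int_closed[OF compact_Icc, of "{t \<in> {c..b}. g t = y}" c b]
  by (simp add: Int_def vimage_def conj_ac cong: conj_cong)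

lemma level_least:
  fixes g :: "real \<Rightarrow> real"
  assumes "continuous_on {c..b} g" "c \<le> t" "t \<le> b" "g t = y"
  obtains m where "c \<le> m" "m \<le> b" "g m = y" "\<And>u. c \<le> u \<Longrightarrow> u \<le> b \<Longrightarrow> g u = y \<Longrightarrow> m \<le> u"
  using compact_attains_inf[OF compact_level[OF assms(1), of y]] assms(2-4)
  by (auto simp: Ball_def)

lemma level_greatest:
  fixes g :: "real \<Rightarrow> real"
  assumes "continuous_on {c..b} g" "c \<le> t" "t \<le> b" "g t = y"
  obtains m where "c \<le> m" "m \<le> b" "g m = y" "\<And>u. c \<le> u \<Longrightarrow> u \<le> b \<Longrightarrow> g u = y \<Longrightarrow> u \<le> m"
  using compact_attains_sup[OF compact_level[OF assms(1), of y]] assms(2-4)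
  by (auto simp: Ball_def)

text \<open>Extremal points of opposite sign are at least \<open>d\<close> apart by uniform continuity, so splitting off the
  first block and continuing at the first extremal point of the opposite sign terminates.\<close>

lemma alternating_blocks_exist:
  fixes g :: "real \<Rightarrow> real"
  assumes g: "continuous_on {a..b} g" and M: "M > 0"
    and le: "\<And>t. t \<in> {a..b} \<Longrightarrow> \<bar>g t\<bar> \<le> M"
    and ex: "t \<in> {a..b}" "\<bar>g t\<bar> = M"
  shows "\<exists>k \<epsilon> tm tp. alternating_blocks g M a b k \<epsilon> tm tp"
proof -
  have "uniformly_continuous_on {a..b} g"
    using compact_uniformly_continuous[OF g compact_Icc] .
  then obtain d where d: "d > 0"
    "\<And>u v. u \<in> {a..b} \<Longrightarrow> v \<in> {a..b} \<Longrightarrow> \<bar>u - v\<bar> < d \<Longrightarrow> \<bar>g u - g v\<bar> < 2 * M"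
    using M unfolding uniformly_continuous_on_def dist_real_def
    by (metis mult_pos_pos zero_less_numeral)
  \<comment> \<open>The induction runs on \<open>m\<close>, a strict bound for the remaining length
    \<open>b - c\<close> in units of \<open>d\<close>. For \<open>m = 0\<close> no point is left to
    carry an extremal value.\<close>
  have "\<exists>k \<epsilon> tm tp. alternating_blocks g M c b k \<epsilon> tm tp"
    if "b - c < real m * d" "a \<le> c" "\<exists>t. c \<le> t \<and> t \<le> b \<and> \<bar>g t\<bar> = M" for c m
    using that
  proof (induction m arbitrary: c)
    case 0
    then show ?case by auto
  next
    case (Suc m)
    have gc: "continuous_on {c'..b'} g" if "c \<le> c'" "b' \<le> b" for c' b'
      by (rule continuous_on_subset[OF g]) (use Suc.prems that in auto)
    obtain t0 where t0: "c \<le> t0" "t0 \<le> b" "\<bar>g t0\<bar> = M"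
      "\<And>u. c \<le> u \<Longrightarrow> u \<le> b \<Longrightarrow> \<bar>g u\<bar> = M \<Longrightarrow> t0 \<le> u"
      using Suc.prems(3) level_least[OF continuous_on_rabs[OF gc[of c b]], of _ M] by auto
    define \<epsilon> where "\<epsilon> = g t0 / M"
    have eps: "\<epsilon> = -1 \<or> \<epsilon> = 1" using t0(3) M by (auto simp: \<epsilon>_def abs_if split: if_splits)
    have g0: "g t0 = \<epsilon> * M" using M by (simp add: \<epsilon>_def)
    have two: "\<bar>g u\<bar> = M \<longleftrightarrow> g u = \<epsilon> * M \<or> g u = - \<epsilon> * M" for u
      using eps M by (auto simp: abs_if)
    show ?case
    \<comment> \<open>If the value opposite to \<open>g t0\<close> never occurs after
      \<open>t0\<close>, a single block reaches to the last extremal point. Otherwise the first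
      block ends at the last point \<open>t1\<close> with value \<open>g t0\<close> before the first
      opposite point \<open>u\<close>, and the rest starts at \<open>u\<close>.\<close>
    proof (cases "\<exists>u. t0 \<le> u \<and> u \<le> b \<and> g u = - \<epsilon> * M")
      case False
      obtain t1 where t1: "t0 \<le> t1" "t1 \<le> b" "g t1 = \<epsilon> * M"
        "\<And>u. t0 \<le> u \<Longrightarrow> u \<le> b \<Longrightarrow> g u = \<epsilon> * M \<Longrightarrow> u \<le> t1"
        using level_greatest[OF gc[of t0 b], of t0 "\<epsilon> * M"] t0 g0 by auto
      have "- M < \<epsilon> * g u" if "t0 \<le> u" "u \<le> t1" for u
      proof -
        have "g u \<noteq> - \<epsilon> * M" "\<bar>g u\<bar> \<le> M"
          using False le[of u] Suc.prems t0 t1 that by auto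
        then show ?thesis using eps by (auto simp: abs_if split: if_splits)
      qed
      moreover have "t0 \<le> u \<and> u \<le> t1" if "c \<le> u" "u \<le> b" "\<bar>g u\<bar> = M" for u
        using that t0(4)[OF that] t1(4)[of u] False two[of u] by auto
      ultimately have "alternating_blocks g M c b 0 \<epsilon> (\<lambda>_. t0) (\<lambda>_. t1)"
        using eps t0 t1 g0 unfolding alternating_blocks_def by auto
      then show ?thesis by blast
    next
      case True
      then obtain u where u: "t0 \<le> u" "u \<le> b" "g u = - \<epsilon> * M"
        "\<And>v. t0 \<le> v \<Longrightarrow> v \<le> b \<Longrightarrow> g v = - \<epsilon> * M \<Longrightarrow> u \<le> v"
        using level_least[OF gc[OF t0(1) order.refl]] by metis
      obtain t1 where t1: "t0 \<le> t1" "t1 \<le> u" "g t1 = \<epsilon> * M"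
        "\<And>v. t0 \<le> v \<Longrightarrow> v \<le> u \<Longrightarrow> g v = \<epsilon> * M \<Longrightarrow> v \<le> t1"
        using level_greatest[OF gc[OF t0(1) u(2)] order.refl u(1) g0] by metis
      have "d \<le> u - t0"
      proof (rule ccontr)
        assume "\<not> d \<le> u - t0"
        then have "\<bar>g u - g t0\<bar> < 2 * M" using d(2)[of u t0] u(1,2) t0(1,2) Suc.prems(2) by simp
        then show False using u(3) g0 eps M by auto
      qed
      then have "b - u < real m * d"
        using Suc.prems(1) t0(1) by (simp add: algebra_simps)
      moreover have guM: "\<bar>g u\<bar> = M" unfolding two using u by simp
      then have "\<exists>t. u \<le> t \<and> t \<le> b \<and> \<bar>g t\<bar> = M" using u(2) by blast
      moreover have "a \<le> u" using Suc.prems(2) t0(1) u(1) by simp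
      ultimately obtain k \<epsilon>' tm tp where IH: "alternating_blocks g M u b k \<epsilon>' tm tp"
        using Suc.IH[of u] by blast
      have tm0: "tm 0 = u"
      proof -
        obtain j where "j \<le> k" "tm j \<le> u" using blocks_cover[OF IH, of u] u guM by auto
        then show ?thesis using blocks_tm_mono[OF IH, of 0 j] blocks_between[OF IH, of 0] by simp
      qed
      \<comment> \<open>The blocks of the tail start at \<open>u\<close> itself, so the value of
        \<open>g\<close> there fixes their sign as \<open>- \<epsilon>\<close>. Prepending one block
        therefore continues the alternation with all indices shifted by one.\<close>
      have "(\<epsilon>' + \<epsilon>) * M = 0"
        using blocks_value(1)[OF IH, of 0] tm0 u(3) by (simp add: algebra_simps)
      then have eps': "\<epsilon>' = - \<epsilon>" using M by simp
      have t1u: "t1 < u" using t1 u eps M by (cases "t1 = u") auto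
      define tm' where "tm' j = (case j of 0 \<Rightarrow> t0 | Suc i \<Rightarrow> tm i)" for j
      define tp' where "tp' j = (case j of 0 \<Rightarrow> t1 | Suc i \<Rightarrow> tp i)" for j
      have inside: "- M < \<epsilon> * g v" if "t0 \<le> v" "v \<le> t1" for v
      proof -
        have "v < u" using that t1u by simp
        then have "g v \<noteq> - \<epsilon> * M" using u(2) u(4)[of v] that by auto
        moreover have "\<bar>g v\<bar> \<le> M" using le[of v] \<open>v < u\<close> Suc.prems(2) t0(1) u(2) that by simp
        ultimately show ?thesis using eps by (auto simp: abs_if split: if_splits)
      qed
      have cover: "\<exists>j\<le>Suc k. v \<in> {tm' j..tp' j}" if v: "c \<le> v" "v \<le> b" "\<bar>g v\<bar> = M" for v
      proof (cases "v < u")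
        case True
        then have "g v \<noteq> - \<epsilon> * M" using t0(4)[OF v] u(4)[of v] v by auto
        then have "v \<in> {tm' 0..tp' 0}"
          using t0(4)[OF v] t1(4)[of v] True two[of v] v by (auto simp: tm'_def tp'_def)
        then show ?thesis by blast
      next
        case False
        then obtain j where "j \<le> k" "tm j \<le> v" "v \<le> tp j"
          using blocks_cover[OF IH, of v] v by auto
        then show ?thesis by (intro exI[of _ "Suc j"]) (auto simp: tm'_def tp'_def)
      qed
      have "alternating_blocks g M c b (Suc k) \<epsilon> tm' tp'"
        unfolding alternating_blocks_def
      proof (intro conjI allI impI ballI)
        show "\<epsilon> \<in> {-1, 1}" using eps by auto
      next
        fix j assume j: "j \<le> Suc k"
        show "c \<le> tm' j"  "tm' j \<le> tp' j" "tp' j \<le> b"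
          using j t0 t1 u blocks_between[OF IH, of "j - 1"]
          by (auto simp: tm'_def tp'_def split: nat.split)
        show "g (tm' j) = \<epsilon> * (-1) ^ j * M" "g (tp' j) = \<epsilon> * (-1) ^ j * M"
          using j g0 t1 blocks_value[OF IH, of "j - 1"] eps'
          by (auto simp: tm'_def tp'_def split: nat.split)
        show "- M < \<epsilon> * (-1) ^ j * g v" if "v \<in> {tm' j..tp' j}" for v
          using j that inside[of v] blocks_inside[OF IH, of "j - 1" v] eps'
          by (auto simp: tm'_def tp'_def split: nat.splits)
      next
        fix j assume j: "j < Suc k"
        show "tp' j < tm' (Suc j)"
          using j t1u tm0 blocks_Suc[OF IH, of "j - 1"]
          by (auto simp: tm'_def tp'_def split: nat.split)
      qed (use cover in auto)
      then show ?thesis by blast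
    qed
  qed
  moreover obtain m :: nat where "b - a < real m * d"
    using ex_less_of_nat_mult[OF d(1)] by blast
  moreover have "\<exists>t. a \<le> t \<and> t \<le> b \<and> \<bar>g t\<bar> = M" using ex by auto
  ultimately show ?thesis by blast
qed

text \<open>Under \<open>\<bar>g t\<bar> \<le> M\<close>, being strictly below \<open>M\<close> off
  the blocks means that every extremal point is covered, and the upper bound inside the blocks
  follows as well.\<close>

lemma is_alternance_data_iff:
  fixes g :: "real \<Rightarrow> real"
  assumes M: "M = (SUP t\<in>{a..b}. g t)" "M > 0" and le: "\<forall>t\<in>{a..b}. \<bar>g t\<bar> \<le> M"
  shows "is_alternance_data a b g k \<epsilon> tm tp \<longleftrightarrow>
    k \<ge> 1 \<and> tm \<in> extensional {0..k} \<and> tp \<in> extensional {0..k} \<and>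
    alternating_blocks g M a b k \<epsilon> tm tp"
proof -
  have val: "\<epsilon> * M = (-1) ^ j * g t \<longleftrightarrow> g t = \<epsilon> * (-1) ^ j * M" for j t
    by (cases "even j") auto
  have upper: "\<epsilon> * (-1) ^ j * g t \<le> M" if "\<epsilon> = -1 \<or> \<epsilon> = 1" "a \<le> t" "t \<le> b" for j t
    using that le[rule_format, of t] by (cases "even j") auto
  have strict: "(\<forall>t\<in>{a..b} - (\<Union>j\<le>k. {tm j..tp j}). \<bar>g t\<bar> < M) \<longleftrightarrow>
      (\<forall>t\<in>{a..b}. \<bar>g t\<bar> = M \<longrightarrow> (\<exists>j\<le>k. t \<in> {tm j..tp j}))"
    using le by (force simp: less_le)
  have ext: "h \<in> {0..k} \<rightarrow>\<^sub>E {a..b} \<longleftrightarrow> h \<in> extensional {0..k} \<and> (\<forall>j\<le>k. a \<le> h j \<and> h j \<le> b)" for h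
    by (auto simp: PiE_iff)
  show ?thesis
  proof
    assume "is_alternance_data a b g k \<epsilon> tm tp"
    then show "k \<ge> 1 \<and> tm \<in> extensional {0..k} \<and> tp \<in> extensional {0..k} \<and>
        alternating_blocks g M a b k \<epsilon> tm tp"
      unfolding is_alternance_data_def Let_def M(1)[symmetric] alternating_blocks_def val strict ext
      by blast
  next
    assume *: "k \<ge> 1 \<and> tm \<in> extensional {0..k} \<and> tp \<in> extensional {0..k} \<and>
        alternating_blocks g M a b k \<epsilon> tm tp"
    then have blocks: "alternating_blocks g M a b k \<epsilon> tm tp" by blast
    have between: "a \<le> tm j \<and> tm j \<le> b \<and> a \<le> tp j \<and> tp j \<le> b" if "j \<le> k" for j
      using blocks_between[OF blocks that] by auto
    have "\<epsilon> * (-1) ^ j * g t \<le> M" if "j \<le> k" "t \<in> {tm j..tp j}" for j t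
      using upper[OF blocks_sign[OF blocks]] between[OF that(1)] that(2) by auto
    then show "is_alternance_data a b g k \<epsilon> tm tp"
      using * between
      unfolding is_alternance_data_def Let_def M(1)[symmetric] alternating_blocks_def val strict ext
      by blast
  qed
qed

text \<open>Existence and uniqueness of the blocks resolve the definite description, so that all
  later arguments can work with \<open>alternating_blocks\<close>.\<close>

lemma alternance_data_blocks:
  fixes g :: "real \<Rightarrow> real"
  assumes ab: "a \<le> b" and g: "continuous_on {a..b} g"
    and M: "M = (SUP t\<in>{a..b}. g t)" "M = - (INF t\<in>{a..b}. g t)" "M > 0"
    and le: "\<And>t. t \<in> {a..b} \<Longrightarrow> \<bar>g t\<bar> \<le> M"
  obtains k \<epsilon> tm tp where "alternance_data a b g = (k, \<epsilon>, tm, tp)"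
    "alternating_blocks g M a b k \<epsilon> tm tp"
proof -
  have ne: "{a..b} \<noteq> {}" using ab by simp
  obtain u where u: "u \<in> {a..b}" "\<And>t. t \<in> {a..b} \<Longrightarrow> g t \<le> g u"
    using continuous_attains_sup[OF compact_Icc ne g] by blast
  have gu: "g u = M" using u unfolding M(1) by (intro cSup_eq_maximum[symmetric]) auto
  obtain v where v: "v \<in> {a..b}" "\<And>t. t \<in> {a..b} \<Longrightarrow> g v \<le> g t"
    using continuous_attains_inf[OF compact_Icc ne g] by blast
  have "(INF t\<in>{a..b}. g t) = g v" using v by (intro cInf_eq_minimum) auto
  then have gv: "g v = - M" using M(2) by simp
  obtain k \<epsilon> tm tp where blocks: "alternating_blocks g M a b k \<epsilon> tm tp"
    using alternating_blocks_exist[OF g M(3) le u(1)] gu M(3) by auto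
  \<comment> \<open>Both \<open>M\<close> and \<open>- M\<close> are attained, but on a single block
    the signed values stay above \<open>- M\<close>.\<close>
  have "k \<noteq> 0"
  proof
    assume "k = 0"
    then have "tm 0 \<le> u" "u \<le> tp 0" "tm 0 \<le> v" "v \<le> tp 0"
      using blocks_cover[OF blocks, of u] blocks_cover[OF blocks, of v] u(1) v(1) gu gv M(3)
      by force+
    then have "- M < \<epsilon> * g u" "- M < \<epsilon> * g v"
      using blocks_inside[OF blocks, of 0] \<open>k = 0\<close> by auto
    then show False using gu gv blocks_sign[OF blocks] by auto
  qed
  \<comment> \<open>Restriction to \<open>{0..k}\<close> picks the extensional representatives, for
    which equality on the indices is equality of functions.\<close>
  define tm' tp' where "tm' = restrict tm {0..k}" and "tp' = restrict tp {0..k}"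
  have blocks': "alternating_blocks g M a b k \<epsilon> tm' tp'"
    using blocks by (simp add: alternating_blocks_def tm'_def tp'_def conj_commute cong: conj_cong)
  have "\<forall>t\<in>{a..b}. \<bar>g t\<bar> \<le> M" using le by blast
  note iff = is_alternance_data_iff[OF M(1,3) this]
  have "alternance_data a b g = (k, \<epsilon>, tm', tp')"
    unfolding alternance_data_def
  proof (rule the_equality)
    show "case (k, \<epsilon>, tm', tp') of (k, \<epsilon>, tm, tp) \<Rightarrow> is_alternance_data a b g k \<epsilon> tm tp"
      using blocks' \<open>k \<noteq> 0\<close> by (auto simp: iff tm'_def tp'_def)
  next
    fix z assume z: "case z of (k, \<epsilon>, tm, tp) \<Rightarrow> is_alternance_data a b g k \<epsilon> tm tp"
    obtain k2 \<epsilon>2 tm2 tp2 where zeq: "z = (k2, \<epsilon>2, tm2, tp2)" by (cases z)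
    then have ext2: "tm2 \<in> extensional {0..k2}" "tp2 \<in> extensional {0..k2}"
      and b2: "alternating_blocks g M a b k2 \<epsilon>2 tm2 tp2"
      using z iff by auto
    note eq1 = blocks_unique_upto[OF blocks' b2 M(3)]
    note eq2 = blocks_unique_upto[OF b2 blocks' M(3)]
    have k: "k = k2" using eq1(2)[of k] eq2(2)[of k2] by simp
    have "tm' = tm2" "tp' = tp2"
      by (rule extensionalityI[of _ "{0..k}"]; use ext2 eq1 k in \<open>auto simp: tm'_def tp'_def\<close>)+
    then show "z = (k, \<epsilon>, tm', tp')" using eq1(1) k zeq by simp
  qed
  then show thesis using that blocks' by blast
qed


section \<open>Spline spaces and the improvement step\<close>

text \<open>At a shared knot both neighbouring polynomials equal \<open>\<sigma>\<close>, which
  yields the matching condition.\<close>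

lemma mem_splines_iff:
  assumes "\<forall>i\<le>p. x i \<le> x (Suc i)"
  shows "\<sigma> \<in> splines p x n \<longleftrightarrow>
    (\<forall>i\<le>p. \<exists>q. degree q \<le> n i \<and> (\<forall>t\<in>{x i..x (Suc i)}. \<sigma> t = poly q t))"
proof
  assume "\<sigma> \<in> splines p x n"
  then show "\<forall>i\<le>p. \<exists>q. degree q \<le> n i \<and> (\<forall>t\<in>{x i..x (Suc i)}. \<sigma> t = poly q t)"
    unfolding splines_def poly_funs_def mem_Collect_eq by metis
next
  assume "\<forall>i\<le>p. \<exists>q. degree q \<le> n i \<and> (\<forall>t\<in>{x i..x (Suc i)}. \<sigma> t = poly q t)"
  then obtain q where q: "\<And>i. i \<le> p \<Longrightarrow> degree (q i) \<le> n i"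
    "\<And>i t. i \<le> p \<Longrightarrow> t \<in> {x i..x (Suc i)} \<Longrightarrow> \<sigma> t = poly (q i) t" by metis
  have "poly (q i) (x (Suc i)) = poly (q (Suc i)) (x (Suc i))" if "i < p" for i
    using q(2)[of i "x (Suc i)"] q(2)[of "Suc i" "x (Suc i)"] assms that
    by simp
  then show "\<sigma> \<in> splines p x n"
    unfolding splines_def poly_funs_def using q by (intro CollectI exI[of _ "\<lambda>i. poly (q i)"]) auto
qed

lemma splines_linear:
  assumes x: "\<forall>i\<le>p. x i \<le> x (Suc i)"
    and "\<sigma> \<in> splines p x n" "\<tau> \<in> splines p x n"
  shows "(\<lambda>t. \<sigma> t - c * \<tau> t) \<in> splines p x n"
  unfolding mem_splines_iff[OF x]
proof (intro allI impI)
  fix i assume "i \<le> p"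
  then obtain q1 q2 where "degree q1 \<le> n i" "\<forall>t\<in>{x i..x (Suc i)}. \<sigma> t = poly q1 t"
    "degree q2 \<le> n i" "\<forall>t\<in>{x i..x (Suc i)}. \<tau> t = poly q2 t"
    using assms(2,3) unfolding mem_splines_iff[OF x] by metis
  then show "\<exists>q. degree q \<le> n i \<and> (\<forall>t\<in>{x i..x (Suc i)}. \<sigma> t - c * \<tau> t = poly q t)"
    by (intro exI[of _ "q1 - smult c q2"]) (auto intro!: degree_diff_le order.trans[OF degree_smult_le])
qed

lemma splines_continuous_on:
  assumes x: "\<forall>i\<le>p. x i \<le> x (Suc i)" and "\<sigma> \<in> splines p x n"
  shows "continuous_on {x 0..x (Suc p)} \<sigma>"
proof -
  have piece: "continuous_on {x i..x (Suc i)} \<sigma>" if "i \<le> p" for i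
  proof -
    obtain q where "\<forall>t\<in>{x i..x (Suc i)}. \<sigma> t = poly q t"
      using assms(2) \<open>i \<le> p\<close> unfolding mem_splines_iff[OF x] by metis
    then show ?thesis
      by (subst continuous_on_cong[OF refl, of _ _ "poly q"]) (auto intro: continuous_intros)
  qed
  have "i \<le> p \<Longrightarrow> x 0 \<le> x (Suc i) \<and> continuous_on {x 0..x (Suc i)} \<sigma>" for i
  proof (induction i)
    case 0
    then show ?case using piece[of 0] x by simp
  next
    case (Suc i)
    then have "x 0 \<le> x (Suc i)" "x (Suc i) \<le> x (Suc (Suc i))" using x by auto
    moreover from this have "continuous_on ({x 0..x (Suc i)} \<union> {x (Suc i)..x (Suc (Suc i))}) \<sigma>"
      using Suc piece[of "Suc i"] by (intro continuous_on_closed_Un) auto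
    ultimately show ?case by (simp add: ivl_disj_un_two_touch)
  qed
  then show ?thesis by simp
qed

text \<open>Clamping the linear factor \<open>z j - t\<close> to its piece keeps it constant on all other pieces, so
  each piece only pays one degree for each of its own zeros and continuity is automatic.\<close>

lemma clamped_product_in_splines:
  fixes x z :: "nat \<Rightarrow> real"
  assumes x: "\<And>i. i \<le> p \<Longrightarrow> x i < x (Suc i)"
    and \<pi>: "\<And>j. j < k \<Longrightarrow> \<pi> j \<le> p" and card: "\<And>i. card {j. j < k \<and> \<pi> j = i} \<le> n i"
  shows "(\<lambda>t. \<Prod>j<k. z j - max (x (\<pi> j)) (min t (x (Suc (\<pi> j))))) \<in> splines p x n"
proof -
  have x_mono: "x i \<le> x j" if "i \<le> j" "j \<le> Suc p" for i j
    using mono_upto[of "Suc p" x i j] x that by simp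
  have "\<exists>q. degree q \<le> n i \<and> (\<forall>t\<in>{x i..x (Suc i)}.
      (\<Prod>j<k. z j - max (x (\<pi> j)) (min t (x (Suc (\<pi> j))))) = poly q t)" if i: "i \<le> p" for i
  proof -
    \<comment> \<open>On piece \<open>i\<close> the clamped factor is linear if it belongs to this
      piece. Otherwise it is frozen at the left or right end of its own piece, whichever is nearer
      to piece \<open>i\<close>.\<close>
    define h where "h j = (if \<pi> j = i then [:z j, -1:] else if i < \<pi> j then [:z j - x (\<pi> j):]
      else [:z j - x (Suc (\<pi> j)):])" for j
    have "degree (\<Prod>j<k. h j) \<le> (\<Sum>j<k. degree (h j))" by (rule degree_prod_sum_le[OF finite_lessThan, unfolded o_def])
    also have "\<dots> \<le> (\<Sum>j<k. if \<pi> j = i then 1 else 0)"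
      by (intro sum_mono) (auto simp: h_def)
    also have "\<dots> = card {j. j < k \<and> \<pi> j = i}"
      by (simp add: sum.If_cases Int_def)
    also have "\<dots> \<le> n i" by (rule card)
    finally have "degree (\<Prod>j<k. h j) \<le> n i" .
    moreover have "z j - max (x (\<pi> j)) (min t (x (Suc (\<pi> j)))) = poly (h j) t"
      if j: "j < k" and t: "t \<in> {x i..x (Suc i)}" for j t
    proof -
      consider "\<pi> j = i" | "Suc i \<le> \<pi> j" | "Suc (\<pi> j) \<le> i" by linarith
      then show ?thesis
      proof cases
        case 2
        then have "x (Suc i) \<le> x (\<pi> j)" using x_mono[of "Suc i" "\<pi> j"] \<pi>[OF j] by simp
        then show ?thesis using 2 t by (simp add: h_def max_absorb1 min.coboundedI1)
      next
        case 3
        then have "x (Suc (\<pi> j)) \<le> x i" using x_mono[of "Suc (\<pi> j)" i] i by simp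
        then show ?thesis using 3 t x[OF \<pi>[OF j]] by (simp add: h_def)
      qed (use t in \<open>auto simp: h_def\<close>)
    qed
    ultimately show ?thesis by (intro exI[of _ "\<Prod>j<k. h j"]) (auto simp: poly_prod intro!: prod.cong)
  qed
  then show ?thesis using mem_splines_iff[of p x] x by (simp add: less_imp_le)
qed

section \<open>Norm estimates and small perturbations\<close>

lemma abs_le_sup_norm:
  assumes "continuous_on {a..b} g" "t \<in> {a..b}" shows "\<bar>g t\<bar> \<le> sup_norm a b g"
  unfolding sup_norm_def
proof (rule cSUP_upper[OF assms(2)])
  have "compact ((\<lambda>t. \<bar>g t\<bar>) ` {a..b})"
    by (intro compact_continuous_image continuous_on_rabs assms compact_Icc)
  then show "bdd_above ((\<lambda>t. \<bar>g t\<bar>) ` {a..b})"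
    by (intro bounded_imp_bdd_above compact_imp_bounded)
qed

lemma sup_norm_less:
  assumes "a \<le> b" "continuous_on {a..b} g" "\<And>t. t \<in> {a..b} \<Longrightarrow> \<bar>g t\<bar> < M"
  shows "sup_norm a b g < M"
proof -
  obtain u where u: "u \<in> {a..b}" "\<And>t. t \<in> {a..b} \<Longrightarrow> \<bar>g t\<bar> \<le> \<bar>g u\<bar>"
    using continuous_attains_sup[OF compact_Icc _ continuous_on_rabs[OF assms(2)]] assms(1) by auto
  then have "sup_norm a b g = \<bar>g u\<bar>" unfolding sup_norm_def by (intro cSup_eq_maximum) auto
  then show ?thesis using assms(3) u by simp
qed

lemma prod_sign:
  fixes c :: "nat \<Rightarrow> real"
  assumes "m \<le> k" "\<And>j. j < m \<Longrightarrow> c j < 0" "\<And>j. m \<le> j \<Longrightarrow> j < k \<Longrightarrow> c j > 0"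
  shows "(-1) ^ m * (\<Prod>j<k. c j) > 0"
  using assms
proof (induction k rule: dec_induct)
  case base
  then have "(\<Prod>j<m. - c j) > 0" by (intro prod_pos) auto
  then show ?case by (simp add: prod_uminus)
next
  case (step k)
  then have "(-1) ^ m * (\<Prod>j<k. c j) > 0" "c k > 0" by auto
  then show ?case by (simp flip: mult.assoc)
qed

text \<open>On the compact set \<open>A\<close> where \<open>g\<close> and \<open>d\<close> do not
  share a strict sign, \<open>\<bar>g\<bar>\<close> stays below \<open>M\<close> by a fixed margin
  \<open>h\<close>, which a small multiple of \<open>d\<close> cannot use up. Off \<open>A\<close>,
  subtracting that multiple moves \<open>g\<close> towards zero, and the step is too short to reach
  the opposite level.\<close>

lemma uniform_improvement:
  fixes g d :: "real \<Rightarrow> real"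
  assumes ab: "a \<le> b" and g: "continuous_on {a..b} g" and d: "continuous_on {a..b} d"
    and M: "M > 0" and le: "\<And>t. t \<in> {a..b} \<Longrightarrow> \<bar>g t\<bar> \<le> M"
    and pos: "\<And>t. t \<in> {a..b} \<Longrightarrow> \<bar>g t\<bar> = M \<Longrightarrow> g t * d t > 0"
  obtains c where "\<And>t. t \<in> {a..b} \<Longrightarrow> \<bar>g t - c * d t\<bar> < M"
proof -
  obtain D where D: "D > 0" "\<And>t. t \<in> {a..b} \<Longrightarrow> \<bar>d t\<bar> \<le> D"
    using compact_imp_bounded[OF compact_continuous_image[OF d]] unfolding bounded_pos by auto
  define A where "A = {t \<in> {a..b}. g t * d t \<le> 0}"
  have "A = {a..b} \<inter> (\<lambda>t. g t * d t) -` {..0}" by (auto simp: A_def)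
  moreover have "closed ({a..b} \<inter> (\<lambda>t. g t * d t) -` {..0})"
    by (intro continuous_closed_preimage continuous_intros g d)
  ultimately have "closed A" by simp
  then have "compact A"
    using compact_Int_closed[OF compact_Icc, of A a b] \<open>A = _ \<inter> _\<close> by simp
  have "\<exists>h>0. \<forall>t\<in>A. \<bar>g t\<bar> \<le> M - h"
  proof (cases "A = {}")
    case False
    have "continuous_on A (\<lambda>t. \<bar>g t\<bar>)"
      by (intro continuous_on_rabs continuous_on_subset[OF g]) (auto simp: A_def)
    then obtain u where u: "u \<in> A" "\<And>t. t \<in> A \<Longrightarrow> \<bar>g t\<bar> \<le> \<bar>g u\<bar>"
      using continuous_attains_sup[OF \<open>compact A\<close> False] by blast
    then have "\<bar>g u\<bar> < M" using le[of u] pos[of u] by (force simp: A_def)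
    then show ?thesis using u by (intro exI[of _ "M - \<bar>g u\<bar>"]) auto
  qed (auto intro: exI[of _ 1])
  then obtain h where h: "h > 0" "\<And>t. t \<in> A \<Longrightarrow> \<bar>g t\<bar> \<le> M - h" by blast
  \<comment> \<open>The step \<open>c * D\<close> must stay below the margin \<open>h\<close> on
    \<open>A\<close> and below \<open>M\<close> off \<open>A\<close>; the factor 2 makes both bounds
    strict.\<close>
  define c where "c = min h M / (2 * D)"
  have c: "c > 0" "c * D < h" "c * D < M" using h D M by (auto simp: c_def min_def)
  show thesis
  proof
    fix t assume t: "t \<in> {a..b}"
    have cd: "\<bar>c * d t\<bar> \<le> c * D" using D(2)[OF t] c(1) by (simp add: abs_mult)
    show "\<bar>g t - c * d t\<bar> < M"
    proof (cases "t \<in> A")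
      case True
      then show ?thesis using h(2)[OF True] cd c by linarith
    next
      case False
      then have "g t * d t > 0" using t by (auto simp: A_def)
      then have "(g t > 0 \<and> c * d t > 0) \<or> (g t < 0 \<and> c * d t < 0)"
        using c(1) by (auto simp: zero_less_mult_iff mult_less_0_iff)
      then show ?thesis using le[OF t] cd c by linarith
    qed
  qed
qed

text \<open>Gap \<open>j\<close> lies between blocks \<open>j\<close> and \<open>j + 1\<close>.
  Sparseness supplies Hall's condition for distributing the \<open>k\<close> gaps over the pieces,
  and a clamped product with one zero in each gap follows the signs of \<open>g\<close>.\<close>

lemma improvement_of_sparse_alternance:
  fixes g :: "real \<Rightarrow> real" and x :: "nat \<Rightarrow> real" and n :: "nat \<Rightarrow> nat"
  assumes x: "\<forall>i\<le>p. x i < x (Suc i)" and ends: "x 0 = a" "x (Suc p) = b"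
    and g: "continuous_on {a..b} g" and M: "M > 0"
    and le: "\<And>t. t \<in> {a..b} \<Longrightarrow> \<bar>g t\<bar> \<le> M"
    and blocks: "alternating_blocks g M a b k \<epsilon> tm tp"
    and sparse: "\<And>i1 i2. i1 < i2 \<Longrightarrow> i2 \<le> Suc p \<Longrightarrow>
      card {j \<in> {0..k}. tm j \<in> {x i1..x i2} \<or> tp j \<in> {x i1..x i2}} \<le> (\<Sum>i\<in>{i1..<i2}. n i) + 1"
  obtains d where "d \<in> splines p x n" "\<And>t. t \<in> {a..b} \<Longrightarrow> \<bar>g t - d t\<bar> < M"
proof -
  have x_mono: "x i \<le> x j" if "i \<le> j" "j \<le> Suc p" for i j
    using mono_upto[of "Suc p" x i j] x that by simp
  have xle: "\<forall>i\<le>p. x i \<le> x (Suc i)" using x by (auto intro: less_imp_le)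
  have gap: "a \<le> tp j" "tp j < tm (Suc j)" "tm (Suc j) \<le> b" if "j < k" for j
    using blocks_between[OF blocks, of j] blocks_between[OF blocks, of "Suc j"]
      blocks_Suc[OF blocks that] that by auto
  \<comment> \<open>\<open>l j\<close> and \<open>r j\<close> are the first and last pieces meeting
    the open gap \<open>j\<close>. The strict inequality sits on the side facing the gap, so a piece
    that only touches a block end at a knot is left out.\<close>
  have "\<exists>i\<le>p. x i \<le> tp j \<and> tp j < x (Suc i)" if "j < k" for j
    using exists_last_true[of "\<lambda>i. x i \<le> tp j" p] gap[OF that] ends by (auto simp: not_le)
  then obtain l where l: "\<And>j. j < k \<Longrightarrow> l j \<le> p \<and> x (l j) \<le> tp j \<and> tp j < x (Suc (l j))"
    by metis
  have "\<exists>i\<le>p. x i < tm (Suc j) \<and> tm (Suc j) \<le> x (Suc i)" if "j < k" for j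
    using exists_last_true[of "\<lambda>i. x i < tm (Suc j)" p] gap[OF that] ends by (auto simp: not_less)
  then obtain r where r:
    "\<And>j. j < k \<Longrightarrow> r j \<le> p \<and> x (r j) < tm (Suc j) \<and> tm (Suc j) \<le> x (Suc (r j))"
    by metis
  have "l i \<le> r j \<and> j - i + 1 \<le> (\<Sum>m\<in>{l i..<Suc (r j)}. n m)" if ij: "i \<le> j" "j < k" for i j
  proof -
    have i: "i < k" using ij by simp
    have lt: "x (l i) < x (Suc (r j))"
      using l[OF i] r[OF ij(2)] gap(2)[OF ij(2)] blocks_tp_mono[OF blocks, of i j] ij by simp
    then have lr: "l i < Suc (r j)"
      using x_mono[of "Suc (r j)" "l i"] l[OF i] by (meson leD leI le_SucI)
    \<comment> \<open>The gaps from \<open>i\<close> to \<open>j\<close> are bordered by one block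
      more than their number. Block \<open>i\<close> reaches the knot interval with its right end,
      all others with their left ends.\<close>
    have "{i..Suc j} \<subseteq> {m \<in> {0..k}. tm m \<in> {x (l i)..x (Suc (r j))} \<or> tp m \<in> {x (l i)..x (Suc (r j))}}"
    proof
      fix m assume m: "m \<in> {i..Suc j}"
      show "m \<in> {m \<in> {0..k}. tm m \<in> {x (l i)..x (Suc (r j))} \<or> tp m \<in> {x (l i)..x (Suc (r j))}}"
      proof (cases "m = i")
        case True
        have "tp i \<le> x (Suc (r j))"
          using r[OF ij(2)] gap(2)[OF ij(2)] blocks_tp_mono[OF blocks, of i j] ij by simp
        then show ?thesis using True l[OF i] i by auto
      next
        case False
        then have "x (l i) \<le> tm m" "tm m \<le> x (Suc (r j))"
          using m ij l[OF i] r[OF ij(2)] blocks_less[OF blocks, of i m]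
            blocks_tm_mono[OF blocks, of m "Suc j"] by auto
        then show ?thesis using m ij by auto
      qed
    qed
    from card_mono[OF _ this] have "j - i + 2 \<le>
        card {m \<in> {0..k}. tm m \<in> {x (l i)..x (Suc (r j))} \<or> tp m \<in> {x (l i)..x (Suc (r j))}}"
      using ij by simp
    also have "\<dots> \<le> (\<Sum>m\<in>{l i..<Suc (r j)}. n m) + 1"
      using lr r[OF ij(2)] by (intro sparse) auto
    finally show ?thesis using lr by linarith
  qed
  then obtain \<pi> where \<pi>: "\<And>j. j < k \<Longrightarrow> l j \<le> \<pi> j \<and> \<pi> j \<le> r j"
    and card: "\<And>i. card {j. j < k \<and> \<pi> j = i} \<le> n i"
    using capacity_assignment[of k l r n] by blast
  have \<pi>_le: "\<pi> j \<le> p" if "j < k" for j using \<pi>[OF that] r[OF that] by simp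
  \<comment> \<open>The zero has to lie inside both the gap and the assigned piece: then clamping
    \<open>t\<close> to the piece does not alter the sign of \<open>z j - t\<close>.\<close>
  have "\<exists>z. tp j < z \<and> z < tm (Suc j) \<and> x (\<pi> j) < z \<and> z < x (Suc (\<pi> j))" if j: "j < k" for j
  proof -
    have "x (\<pi> j) < tm (Suc j)" "tp j < x (Suc (\<pi> j))"
      using x_mono[of "\<pi> j" "r j"] x_mono[of "Suc (l j)" "Suc (\<pi> j)"] \<pi>[OF j] l[OF j] r[OF j]
      by auto
    then have "max (tp j) (x (\<pi> j)) < min (tm (Suc j)) (x (Suc (\<pi> j)))"
      using gap(2)[OF j] x \<pi>_le[OF j] by simp
    then obtain w where "max (tp j) (x (\<pi> j)) < w" "w < min (tm (Suc j)) (x (Suc (\<pi> j)))"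
      using dense by blast
    then show ?thesis by (intro exI[of _ w]) simp
  qed
  then obtain z where z: "\<And>j. j < k \<Longrightarrow>
      tp j < z j \<and> z j < tm (Suc j) \<and> x (\<pi> j) < z j \<and> z j < x (Suc (\<pi> j))"
    by metis
  define c where "c t j = z j - max (x (\<pi> j)) (min t (x (Suc (\<pi> j))))" for t j
  define \<delta> where "\<delta> t = (\<Prod>j<k. c t j)" for t
  have spline: "\<delta> \<in> splines p x n"
    unfolding \<delta>_def[abs_def] c_def
  proof (rule clamped_product_in_splines)
    show "x i < x (Suc i)" if "i \<le> p" for i using x that by blast
  qed (fact \<pi>_le card)+
  \<comment> \<open>On block \<open>m\<close> exactly the factors of the \<open>m\<close> preceding
    gaps are negative.\<close>
  have sign: "(-1) ^ m * \<delta> t > 0" if m: "m \<le> k" and t: "tm m \<le> t" "t \<le> tp m" for m t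
    unfolding \<delta>_def
  proof (rule prod_sign[OF m])
    fix j assume j: "j < m"
    then have "tm (Suc j) \<le> t" using blocks_tm_mono[OF blocks, of "Suc j" m] m t by simp
    moreover have "z j < tm (Suc j)" "z j < x (Suc (\<pi> j))" using z[of j] j m by simp_all
    ultimately show "c t j < 0" by (simp add: c_def less_max_iff_disj)
  next
    fix j assume j: "m \<le> j" "j < k"
    then have "t \<le> tp j" using blocks_tp_mono[OF blocks, of m j] t by simp
    moreover have "tp j < z j" "x (\<pi> j) < z j" using z[of j] j by simp_all
    ultimately show "c t j > 0" by (simp add: c_def min_less_iff_disj)
  qed
  have pos: "g t * (\<epsilon> * \<delta> t) > 0" if t: "t \<in> {a..b}" "\<bar>g t\<bar> = M" for t
  proof -
    obtain j where j: "j \<le> k" "tm j \<le> t" "t \<le> tp j" using blocks_cover[OF blocks] t by auto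
    have "- M < \<epsilon> * (-1) ^ j * g t" by (rule blocks_inside[OF blocks j])
    moreover have "\<bar>\<epsilon> * (-1) ^ j * g t\<bar> = M"
      using t(2) blocks_sign[OF blocks] by (auto simp: abs_mult)
    ultimately have "\<epsilon> * (-1) ^ j * g t > 0" using M by linarith
    then have "(\<epsilon> * (-1) ^ j * g t) * ((-1) ^ j * \<delta> t) > 0" using sign[OF j] by (rule mult_pos_pos)
    then show ?thesis by (cases "even j") (simp_all add: mult_ac)
  qed
  have "a \<le> b" using x_mono[of 0 "Suc p"] ends by simp
  moreover have "continuous_on {a..b} (\<lambda>t. \<epsilon> * \<delta> t)"
    using splines_continuous_on[OF xle spline] ends by (auto intro: continuous_intros)
  ultimately obtain e where e: "\<And>t. t \<in> {a..b} \<Longrightarrow> \<bar>g t - e * (\<epsilon> * \<delta> t)\<bar> < M"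
    using uniform_improvement[OF _ g _ M le pos] by blast
  \<comment> \<open>This is \<open>e * \<epsilon> * \<delta> t\<close>, written in the form that
    \<open>splines_linear\<close> provides.\<close>
  have "(\<lambda>t. \<delta> t - (1 - e * \<epsilon>) * \<delta> t) \<in> splines p x n" by (rule splines_linear[OF xle spline spline])
  then show thesis
    by (rule that) (use e in \<open>simp add: algebra_simps\<close>)
qed

text \<open>At a block end \<open>\<bar>g\<bar> = M\<close>, so \<open>d\<close> has the sign of
  \<open>g\<close> there. One such end per counted block gives an alternating sequence for
  \<open>d\<close>, with one sign change fewer than points; this is the 1 in the bound.\<close>

lemma alternance_le_degrees:
  fixes g d :: "real \<Rightarrow> real" and x :: "nat \<Rightarrow> real" and n :: "nat \<Rightarrow> nat"
  assumes x: "\<forall>i\<le>p. x i < x (Suc i)" and ends: "x 0 = a" "x (Suc p) = b"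
    and blocks: "alternating_blocks g M a b k \<epsilon> tm tp"
    and d: "d \<in> splines p x n" "\<And>t. t \<in> {a..b} \<Longrightarrow> \<bar>g t - d t\<bar> < M"
    and i: "i1 < i2" "i2 \<le> Suc p"
  shows "card {j \<in> {0..k}. tm j \<in> {x i1..x i2} \<or> tp j \<in> {x i1..x i2}} \<le> (\<Sum>i\<in>{i1..<i2}. n i) + 1"
    (is "card ?J \<le> _")
proof (cases "?J = {}")
  case False
  define J where "J = ?J"
  have J_iff: "j \<in> J \<longleftrightarrow> j \<le> k \<and> (tm j \<in> {x i1..x i2} \<or> tp j \<in> {x i1..x i2})" for j
    by (simp add: J_def)
  have xle: "\<forall>i\<le>p. x i \<le> x (Suc i)" using x by (auto intro: less_imp_le)
  define e where "e j = (if tm j \<in> {x i1..x i2} then tm j else tp j)" for j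
  have e: "e j \<in> {x i1..x i2}" "tm j \<le> e j" "e j \<le> tp j" "g (e j) = \<epsilon> * (-1) ^ j * M"
    "e j \<in> {a..b}" if "j \<in> J" for j
  proof -
    have j: "j \<le> k" "tm j \<in> {x i1..x i2} \<or> tp j \<in> {x i1..x i2}" using that by (simp_all add: J_iff)
    show "e j \<in> {x i1..x i2}" using j(2) by (auto simp: e_def)
    show "tm j \<le> e j" "e j \<le> tp j" "e j \<in> {a..b}"
      using blocks_between[OF blocks j(1)] by (auto simp: e_def)
    show "g (e j) = \<epsilon> * (-1) ^ j * M" using blocks_value[OF blocks j(1)] by (simp add: e_def)
  qed
  have "finite J" "J \<noteq> {}" using False by (simp_all add: J_def)
  then have J: "finite J" "Min J \<in> J" "Max J \<in> J" "Min J \<le> Max J" by simp_all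
  \<comment> \<open>Signs alternate along consecutive indices, so \<open>J\<close> must have no
    holes: the left end of an intermediate block lies between points of the two outer blocks that
    are in the knot interval.\<close>
  have convex: "{Min J..Max J} \<subseteq> J"
  proof
    fix m assume m: "m \<in> {Min J..Max J}"
    show "m \<in> J"
    proof (cases "m = Min J \<or> m = Max J")
      case True
      then show ?thesis using J by metis
    next
      case False
      then have "Min J < m" "m < Max J" using m by auto
      moreover have "Max J \<le> k" using J(3) by (simp add: J_iff)
      ultimately have "tp (Min J) < tm m" "tm m < tm (Max J)" "m \<le> k"
        using blocks_less[OF blocks, of "Min J" m] blocks_less[OF blocks, of m "Max J"]
          blocks_between[OF blocks, of m] by simp_all
      then have "x i1 \<le> tm m" "tm m \<le> x i2"
        using e(1,3)[OF J(2)] e(1,2)[OF J(3)] by simp_all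
      then show ?thesis using \<open>m \<le> k\<close> by (simp add: J_iff)
    qed
  qed
  define r where "r = Max J - Min J"
  have inJ: "Min J + j \<in> J" if "j \<le> r" for j
    by (rule subsetD[OF convex]) (use that J(4) in \<open>simp add: r_def\<close>)
  have "r \<le> (\<Sum>i\<in>{i1..<i2}. n i)"
  proof (rule spline_alternation_le[where s = "\<lambda>j. e (Min J + j)" and d = d and x = x
        and \<eta> = "\<epsilon> * (-1) ^ Min J"])
    show "i1 \<le> i2" using i by simp
    show "x i \<le> x (Suc i)" "\<exists>q. degree q \<le> n i \<and> (\<forall>t\<in>{x i..x (Suc i)}. d t = poly q t)"
      if "i1 \<le> i" "i < i2" for i
      using that i xle d(1) mem_splines_iff[OF xle, of d n] by auto
    show "e (Min J + j) < e (Min J + Suc j)" if "j < r" for j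
    proof -
      have "Min J + Suc j \<le> k" using inJ[of "Suc j"] that by (simp add: J_iff)
      then have "tp (Min J + j) < tm (Min J + Suc j)"
        using blocks_less[OF blocks, of "Min J + j" "Min J + Suc j"] by simp
      moreover have "e (Min J + j) \<le> tp (Min J + j)" "tm (Min J + Suc j) \<le> e (Min J + Suc j)"
        using e(3)[OF inJ, of j] e(2)[OF inJ, of "Suc j"] that by simp_all
      ultimately show ?thesis by linarith
    qed
    show "e (Min J + j) \<in> {x i1..x i2}" if "j \<le> r" for j
      using e(1)[OF inJ[OF that]] .
    show "\<epsilon> * (-1) ^ Min J * (-1) ^ j * d (e (Min J + j)) > 0" if "j \<le> r" for j
    proof -
      \<comment> \<open>\<open>u\<close> is the sign of \<open>g\<close> at the chosen point. As
        \<open>g\<close> equals \<open>u * M\<close> there, a distance below \<open>M\<close> forces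
        \<open>d\<close> to have sign \<open>u\<close>.\<close>
      define u where "u = \<epsilon> * (-1) ^ (Min J + j)"
      have u: "u = 1 \<or> u = -1"
        using blocks_sign[OF blocks] by (cases "even (Min J + j)") (auto simp: u_def)
      have "g (e (Min J + j)) = u * M" "\<bar>g (e (Min J + j)) - d (e (Min J + j))\<bar> < M"
        using e(4)[OF inJ[OF that]] d(2)[OF e(5)[OF inJ[OF that]]] by (simp_all add: u_def)
      then have "u * d (e (Min J + j)) > 0" using u by auto
      then show ?thesis by (simp add: u_def power_add mult.assoc)
    qed
  qed
  moreover have "J \<subseteq> {Min J..Max J}" using J(1) by auto
  then have "card J \<le> r + 1"
    using card_mono[of "{Min J..Max J}" J] J(4) by (simp add: r_def)
  ultimately show ?thesis unfolding J_def by linarith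
next
  case True
  then show ?thesis by (simp only: card.empty)
qed

section \<open>The alternance criterion for best approximation by splines\<close>

theorem theorem4p1:
  fixes a b :: real and f \<sigma> :: "real \<Rightarrow> real"
    and p :: nat and x :: "nat \<Rightarrow> real" and n :: "nat \<Rightarrow> nat"
  assumes "continuous_on {a..b} f"
    and "x 0 = a" and "x (Suc p) = b" and "\<And>i. i \<le> p \<Longrightarrow> x i < x (Suc i)"
    and "\<And>i. i \<le> p \<Longrightarrow> n i \<ge> 1"
    and "\<sigma> \<in> splines p x n"
    and "(SUP t\<in>{a..b}. \<sigma> t - f t) = - (INF t\<in>{a..b}. \<sigma> t - f t)"
    and "(SUP t\<in>{a..b}. \<sigma> t - f t) > 0"
  shows "is_arg_min (\<lambda>\<tau>. sup_norm a b (\<lambda>t. \<tau> t - f t)) (\<lambda>\<tau>. \<tau> \<in> splines p x n) \<sigma> \<longleftrightarrow>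
         (\<exists>i\<^sub>1 i\<^sub>2. i\<^sub>1 < i\<^sub>2 \<and> i\<^sub>2 \<le> p + 1 \<and>
            card (alternance_indices a b (\<lambda>t. \<sigma> t - f t) x i\<^sub>1 i\<^sub>2) \<ge> (\<Sum>i\<in>{i\<^sub>1..<i\<^sub>2}. n i) + 2)"
proof -
  define g where "g t = \<sigma> t - f t" for t
  have g_eq: "(\<lambda>t. \<sigma> t - f t) = g" by (simp add: g_def fun_eq_iff)
  define M where "M = (SUP t\<in>{a..b}. g t)"
  have x: "\<forall>i\<le>p. x i < x (Suc i)" and xle: "\<forall>i\<le>p. x i \<le> x (Suc i)"
    using assms(4) by (auto intro: less_imp_le)
  note ends = assms(2,3)
  have ab: "a \<le> b" using mono_upto[of "Suc p" x 0 "Suc p"] assms(4) ends by simp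
  have diff: "continuous_on {a..b} (\<lambda>t. \<tau> t - f t)" if "\<tau> \<in> splines p x n" for \<tau>
    using splines_continuous_on[OF xle that] ends assms(1) by (auto intro: continuous_intros)
  have g: "continuous_on {a..b} g" using diff[OF assms(6)] unfolding g_eq .
  have M: "M = (SUP t\<in>{a..b}. g t)" "M = - (INF t\<in>{a..b}. g t)" "M > 0"
    using assms(7,8) unfolding M_def g_eq by simp_all
  have bounded: "bounded (g ` {a..b})"
    using compact_imp_bounded[OF compact_continuous_image[OF g compact_Icc]] .
  have le: "\<bar>g t\<bar> \<le> M" if "t \<in> {a..b}" for t
  proof -
    have "g t \<le> M" unfolding M(1)
      by (rule cSUP_upper[OF that bounded_imp_bdd_above[OF bounded]])
    moreover have "- M \<le> g t" unfolding M(2)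
      using cINF_lower[OF bounded_imp_bdd_below[OF bounded] that] by simp
    ultimately show ?thesis by simp
  qed
  obtain k \<epsilon> tm tp where data: "alternance_data a b g = (k, \<epsilon>, tm, tp)"
    and blocks: "alternating_blocks g M a b k \<epsilon> tm tp"
    using alternance_data_blocks[OF ab g M le] by blast
  have J: "alternance_indices a b (\<lambda>t. \<sigma> t - f t) x i1 i2 =
      {j \<in> {0..k}. tm j \<in> {x i1..x i2} \<or> tp j \<in> {x i1..x i2}}" for i1 i2
    unfolding alternance_indices_def g_eq data by simp
  have norm_le: "sup_norm a b g \<le> M"
    unfolding sup_norm_def by (rule cSUP_least) (use ab le in auto)
  \<comment> \<open>The correspondence is \<open>d = \<sigma> - \<tau>\<close>, for which
    \<open>g - d = \<tau> - f\<close>. Since \<open>\<bar>g\<bar>\<close> reaches \<open>M\<close>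
    at \<open>tm 0\<close> and continuous functions attain their norm, a smaller norm amounts to a
    strict pointwise bound by \<open>M\<close>.\<close>
  have improvable: "(\<exists>\<tau>. \<tau> \<in> splines p x n \<and> sup_norm a b (\<lambda>t. \<tau> t - f t) < sup_norm a b g) \<longleftrightarrow>
      (\<exists>d. d \<in> splines p x n \<and> (\<forall>t\<in>{a..b}. \<bar>g t - d t\<bar> < M))"
  proof (intro iffI; elim exE conjE)
    fix \<tau> assume \<tau>: "\<tau> \<in> splines p x n" "sup_norm a b (\<lambda>t. \<tau> t - f t) < sup_norm a b g"
    have "\<bar>\<tau> t - f t\<bar> < M" if "t \<in> {a..b}" for t
      using abs_le_sup_norm[OF diff[OF \<tau>(1)] that] \<tau>(2) norm_le by simp
    then have "\<bar>g t - (\<sigma> t - 1 * \<tau> t)\<bar> < M" if "t \<in> {a..b}" for t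
      using that by (simp add: g_def)
    then show "\<exists>d. d \<in> splines p x n \<and> (\<forall>t\<in>{a..b}. \<bar>g t - d t\<bar> < M)"
      using splines_linear[OF xle assms(6) \<tau>(1), of 1] by blast
  next
    fix d assume d: "d \<in> splines p x n" "\<forall>t\<in>{a..b}. \<bar>g t - d t\<bar> < M"
    have \<tau>: "(\<lambda>t. \<sigma> t - 1 * d t) \<in> splines p x n" by (rule splines_linear[OF xle assms(6) d(1)])
    have "sup_norm a b (\<lambda>t. (\<sigma> t - 1 * d t) - f t) < M"
    proof (rule sup_norm_less[OF ab diff[OF \<tau>]])
      fix t assume "t \<in> {a..b}"
      then have "\<bar>g t - d t\<bar> < M" using d(2) by blast
      then show "\<bar>\<sigma> t - 1 * d t - f t\<bar> < M" by (simp add: g_def diff_right_commute)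
    qed
    moreover have "M \<le> sup_norm a b g"
      using abs_le_sup_norm[OF g, of "tm 0"] blocks_between[OF blocks, of 0]
        blocks_extreme(1)[OF blocks, of 0] M(3) by simp
    ultimately have "sup_norm a b (\<lambda>t. (\<sigma> t - 1 * d t) - f t) < sup_norm a b g" by linarith
    with \<tau> show "\<exists>\<tau>. \<tau> \<in> splines p x n \<and> sup_norm a b (\<lambda>t. \<tau> t - f t) < sup_norm a b g"
      by (intro exI[of _ "\<lambda>t. \<sigma> t - 1 * d t"] conjI)
  qed
  have "is_arg_min (\<lambda>\<tau>. sup_norm a b (\<lambda>t. \<tau> t - f t)) (\<lambda>\<tau>. \<tau> \<in> splines p x n) \<sigma> \<longleftrightarrow>
      \<not> (\<exists>d. d \<in> splines p x n \<and> (\<forall>t\<in>{a..b}. \<bar>g t - d t\<bar> < M))"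
    unfolding is_arg_min_def g_eq improvable[symmetric] using assms(6) by blast
  also have "\<dots> \<longleftrightarrow> (\<exists>i1 i2. i1 < i2 \<and> i2 \<le> p + 1 \<and>
      card {j \<in> {0..k}. tm j \<in> {x i1..x i2} \<or> tp j \<in> {x i1..x i2}} \<ge> (\<Sum>i\<in>{i1..<i2}. n i) + 2)"
    (is "\<not> ?better \<longleftrightarrow> ?dense")
  proof
    assume no: "\<not> ?better"
    show ?dense
    proof (rule ccontr)
      assume not_dense: "\<not> ?dense"
      show False
      proof (rule improvement_of_sparse_alternance[OF x ends g M(3) _ blocks])
        fix i1 i2 assume i: "i1 < i2" "i2 \<le> Suc p"
        then have "\<not> card {j \<in> {0..k}. tm j \<in> {x i1..x i2} \<or> tp j \<in> {x i1..x i2}}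
            \<ge> (\<Sum>i\<in>{i1..<i2}. n i) + 2"
          using not_dense unfolding Suc_eq_plus1 by blast
        then show "card {j \<in> {0..k}. tm j \<in> {x i1..x i2} \<or> tp j \<in> {x i1..x i2}}
            \<le> (\<Sum>i\<in>{i1..<i2}. n i) + 1"
          by linarith
      next
        fix d assume "d \<in> splines p x n" "\<And>t. t \<in> {a..b} \<Longrightarrow> \<bar>g t - d t\<bar> < M"
        then show False using no by blast
      qed (rule le)
    qed
  next
    assume ?dense
    then show "\<not> ?better"
    proof (elim exE conjE, intro notI, elim exE conjE)
      fix i1 i2 d
      assume "i1 < i2" "i2 \<le> p + 1" "d \<in> splines p x n" "\<forall>t\<in>{a..b}. \<bar>g t - d t\<bar> < M"
      then have "card {j \<in> {0..k}. tm j \<in> {x i1..x i2} \<or> tp j \<in> {x i1..x i2}}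
          \<le> (\<Sum>i\<in>{i1..<i2}. n i) + 1"
        by (intro alternance_le_degrees[OF x ends blocks]) auto
      moreover assume "card {j \<in> {0..k}. tm j \<in> {x i1..x i2} \<or> tp j \<in> {x i1..x i2}}
          \<ge> (\<Sum>i\<in>{i1..<i2}. n i) + 2"
      ultimately show False by linarith
    qed
  qed
  finally show ?thesis unfolding J .
qed

end
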